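(* Let $S$ be a numerical monoid. (1) If $S'$ is a numerical monoid such that $\mathcal P_{\mathrm{fin},0}(S')$ is isomorphic to $\mathcal P_{\mathrm{fin},0}(S)$, then $|\mathcal A(S)|=|\mathcal A(S')|$ and $m(S)=m(S')$. (2) There are only finitely many numerical monoids $S'$ such that $\mathcal P_{\mathrm{fin},0}(S')$ is isomorphic to $\mathcal P_{\mathrm{fin},0}(S)$.
   Context: A numerical monoid is an additive submonoid $S\subset\mathbb N_0$ with $\gcd(S)=1$; $\mathcal A(S)$ is its set of atoms (nonzero elements of $S$ that are not a sum of two nonzero elements of $S$), which is its minimal generating set. $m(S)$ denotes the smallest integer $m\ge\max\mathcal A(S)$ such that both $m$ and $m-1$ lie in $S$. $\mathcal P_{\mathrm{fin},0}(S)$ is the monoid of finite subsets of $S$ containing $0$ under set addition $A+B=\{a+b\colon a\in A,b\in B\}$; isomorphism means monoid isomorphism. *)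

theory Defs
  imports "HOL-Algebra.Group" "HOL-Library.Set_Algebras"
begin

definition numerical_monoid :: "nat set \<Rightarrow> bool" where
  "numerical_monoid S \<longleftrightarrow> 0 \<in> S \<and> (\<forall>x\<in>S. \<forall>y\<in>S. x + y \<in> S) \<and> Gcd S = 1"

definition atoms :: "nat set \<Rightarrow> nat set" where
  "atoms S = {a \<in> S. a \<noteq> 0 \<and> \<not> (\<exists>x\<in>S. \<exists>y\<in>S. x \<noteq> 0 \<and> y \<noteq> 0 \<and> a = x + y)}"

text \<open>
  For a numerical monoid \<open>S\<close> the set \<open>atoms S\<close> is finite, nonempty and does not contain 0, and an
  integer \<open>m\<close> as required exists (lemmas \<open>finite_atoms\<close>, \<open>atoms_nonempty\<close>, \<open>m_of_exists\<close>
  below).  So \<open>Max\<close> and \<open>LEAST\<close> are meaningful, and \<open>m - 1\<close> is never truncated.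
\<close>

definition m_of :: "nat set \<Rightarrow> nat" where
  "m_of S = (LEAST m. m \<ge> Max (atoms S) \<and> m \<in> S \<and> m - 1 \<in> S)"

text \<open>
  The operation is the elementwise sum of sets from \<^theory>\<open>HOL-Library.Set_Algebras\<close>.  Monoid
  isomorphism is \<^const>\<open>is_iso\<close>: it does not mention the neutral element, but a multiplicative
  bijection between monoids automatically preserves it.
\<close>

definition Pfin0 :: "nat set \<Rightarrow> nat set monoid" where
  "Pfin0 S = \<lparr>carrier = {A. finite A \<and> A \<subseteq> S \<and> 0 \<in> A}, mult = (+), one = {0}\<rparr>"

lemma comm_monoid_Pfin0:
  assumes "numerical_monoid S"
  shows "comm_monoid (Pfin0 S)"
proof (rule comm_monoidI)
  fix A B assume "A \<in> carrier (Pfin0 S)" "B \<in> carrier (Pfin0 S)"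
  then show "A \<otimes>\<^bsub>Pfin0 S\<^esub> B \<in> carrier (Pfin0 S)"
    using assms by (force simp: Pfin0_def numerical_monoid_def set_plus_def
        intro: finite_set_plus[unfolded set_plus_def])
next
  show "\<one>\<^bsub>Pfin0 S\<^esub> \<in> carrier (Pfin0 S)"
    using assms by (simp add: Pfin0_def numerical_monoid_def)
next
  show "\<one>\<^bsub>Pfin0 S\<^esub> \<otimes>\<^bsub>Pfin0 S\<^esub> A = A" for A
    by (simp add: Pfin0_def set_plus_def)
qed (simp_all add: Pfin0_def ac_simps)

lemma numerical_monoid_nonzero:
  assumes "numerical_monoid S"
  obtains a where "a \<in> S" "a \<noteq> 0"
proof -
  have "\<not> S \<subseteq> {0}"
    using assms Gcd_0_iff[of S] by (auto simp: numerical_monoid_def)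
  then show ?thesis using that by blast
qed

lemma numerical_monoid_mult:
  assumes "numerical_monoid S" "a \<in> S"
  shows "k * a \<in> S"
  using assms by (induction k) (auto simp: numerical_monoid_def)

lemma finite_atoms:
  assumes S: "numerical_monoid S"
  shows "finite (atoms S)"
proof -
  obtain a where a: "a \<in> S" "a \<noteq> 0" using numerical_monoid_nonzero[OF S] .
  have *: False if "x \<in> atoms S" "y \<in> atoms S" "x < y" "x mod a = y mod a" for x y
  proof -
    have "a dvd y - x" using that by (metis less_imp_le mod_eq_dvd_iff_nat)
    then obtain k where k: "y - x = a * k" ..
    then have "y = x + k * a" "k * a \<noteq> 0" using that a(2) by (auto simp: mult.commute intro!: gr0I)
    moreover have "k * a \<in> S" using numerical_monoid_mult[OF S a(1)] .
    ultimately show False using that unfolding atoms_def by blast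
  qed
  have "inj_on (\<lambda>x. x mod a) (atoms S)"
    by (rule inj_onI) (metis * linorder_neqE_nat)
  moreover have "(\<lambda>x. x mod a) ` atoms S \<subseteq> {..<a}" using a by auto
  ultimately show ?thesis by (meson finite_lessThan inj_on_finite)
qed

lemma atoms_nonempty:
  assumes S: "numerical_monoid S"
  shows "atoms S \<noteq> {}"
proof -
  obtain a where a: "a \<in> S" "a \<noteq> 0" using numerical_monoid_nonzero[OF S] .
  define b where "b = (LEAST b. b \<in> S \<and> b \<noteq> 0)"
  have b: "b \<in> S" "b \<noteq> 0"
    using LeastI[of "\<lambda>b. b \<in> S \<and> b \<noteq> 0", OF conjI[OF a]] by (auto simp: b_def)
  have le: "b \<le> c" if "c \<in> S" "c \<noteq> 0" for c
    unfolding b_def using that by (intro Least_le) auto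
  have "b \<in> atoms S" using b le by (fastforce simp: atoms_def)
  then show ?thesis by blast
qed

lemma m_of_exists:
  assumes S: "numerical_monoid S"
  shows "\<exists>m \<ge> Max (atoms S). m \<in> S \<and> m - 1 \<in> S"
proof -
  obtain a where a: "a \<in> S" "a \<noteq> 0" using numerical_monoid_nonzero[OF S] .
  have add: "x + y \<in> S" if "x \<in> S" "y \<in> S" for x y
    using S that by (auto simp: numerical_monoid_def)
  define P where "P d \<longleftrightarrow> d \<noteq> 0 \<and> (\<exists>x\<in>S. x + d \<in> S)" for d
  define d where "d = (LEAST d. P d)"
  have "P a" using a S by (auto simp: P_def numerical_monoid_def intro!: bexI[of _ 0])
  then have "P d" unfolding d_def by (rule LeastI)
  then obtain x where x: "x \<in> S" "x + d \<in> S" "d \<noteq> 0" by (auto simp: P_def)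
  have "d dvd s" if s: "s \<in> S" for s
  proof (rule ccontr)
    assume "\<not> d dvd s"
    then have r: "s mod d \<noteq> 0" by (simp add: dvd_eq_mod_eq_0)
    define q where "q = s div d"
    have "q * (x + d) \<in> S" "s + q * x \<in> S"
      using numerical_monoid_mult[OF S] x s add by auto
    moreover have "s + q * x = q * (x + d) + s mod d"
      by (metis q_def add.assoc add.commute distrib_left div_mult_mod_eq)
    ultimately have "P (s mod d)" using r by (auto simp: P_def)
    then have "d \<le> s mod d" unfolding d_def by (rule Least_le)
    then show False using x(3) mod_less_divisor[of d s] by linarith
  qed
  then have "d dvd Gcd S" by (rule Gcd_greatest)
  then have d1: "d = 1" using S by (simp add: numerical_monoid_def)
  define M where "M = Max (atoms S)"
  have "M * a + x \<in> S" "M * a + (x + 1) \<in> S"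
    using numerical_monoid_mult[OF S a(1)] x(1) x(2)[unfolded d1] by (blast intro: add)+
  moreover have "M \<le> M * a + (x + 1)" using a(2) mult_le_mono2[of 1 a M] by linarith
  ultimately show ?thesis unfolding M_def
    by (intro exI[of _ "Max (atoms S) * a + (x + 1)"]) auto
qed

end

theory Submission
  imports Defs
begin

text \<open>
  The universal cancellative quotient of \<open>Pfin0 S\<close> is \<open>S\<close> itself, by way of \<open>Max\<close>: two elements
  \<open>B\<close>, \<open>C\<close> have the same maximum iff \<open>B + D = C + D\<close> for some \<open>D\<close>, since adding a long initial
  segment of \<open>S\<close> to \<open>B\<close> gives an initial segment of \<open>S\<close> that depends only on \<open>Max B\<close>.  So an
  isomorphism between \<open>Pfin0 S\<close> and \<open>Pfin0 S'\<close> induces one between \<open>S\<close> and \<open>S'\<close>.  An additive map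
  \<open>g\<close> satisfies \<open>g s * t = g t * s\<close>, and taking the gcd over all \<open>t\<close> yields \<open>g s = s\<close>, so \<open>S = S'\<close>,
  which is more than what is claimed.
\<close>

lemma numerical_monoid_add:
  "numerical_monoid S \<Longrightarrow> x \<in> S \<Longrightarrow> y \<in> S \<Longrightarrow> x + y \<in> S"
  by (auto simp: numerical_monoid_def)

text \<open>Consecutive elements \<open>k\<close> and \<open>Suc k\<close> of \<open>S\<close>
  already generate every \<open>n\<close> from \<open>k * k\<close> on: for
  \<open>n = q * k + r\<close> with \<open>r < k\<close>, the bound gives \<open>r \<le> q\<close>,
  so \<open>n = (q - r) * k + r * Suc k\<close>.\<close>

lemma numerical_monoid_cofinite:
  assumes S: "numerical_monoid S"
  obtains c where "\<And>n. c \<le> n \<Longrightarrow> n \<in> S"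
proof -
  obtain m where m: "Max (atoms S) \<le> m" "m \<in> S" "m - 1 \<in> S"
    using m_of_exists[OF S] by blast
  have "Max (atoms S) \<in> atoms S"
    using finite_atoms[OF S] atoms_nonempty[OF S] by (rule Max_in)
  \<comment> \<open>This forces \<open>m > 0\<close>, so \<open>m - 1\<close> is a true predecessor
    and \<open>m = Suc k\<close>.\<close>
  then have "Max (atoms S) \<noteq> 0"
    by (auto simp: atoms_def)
  define k where "k = m - 1"
  have k: "k \<in> S" "Suc k \<in> S"
    using m \<open>Max (atoms S) \<noteq> 0\<close> by (auto simp: k_def)
  have "n \<in> S" if n: "k * k \<le> n" for n
  proof (cases "k = 0")
    case True
    then show ?thesis using numerical_monoid_mult[OF S k(2), of n] by simp
  next
    case False
    define q r where "q = n div k" and "r = n mod k"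
    have "r < k" using False by (simp add: r_def)
    also have "k \<le> q" using n False by (simp add: q_def less_eq_div_iff_mult_less_eq)
    finally have "(q - r) * k + r * Suc k = q * k + r"
      by (simp add: diff_mult_distrib)
    also have "\<dots> = n" by (simp add: q_def r_def)
    finally show ?thesis
      using numerical_monoid_add[OF S numerical_monoid_mult[OF S k(1)] numerical_monoid_mult[OF S k(2)]]
      by metis
  qed
  then show ?thesis by (rule that)
qed

lemma Max_set_plus:
  fixes A B :: "nat set"
  assumes "finite A" "A \<noteq> {}" "finite B" "B \<noteq> {}"
  shows "Max (A + B) = Max A + Max B"
proof (rule Max_eqI)
  show "finite (A + B)" using assms by (intro finite_set_plus)
  show "Max A + Max B \<in> A + B" using assms by (intro set_plus_intro Max_in)
  show "y \<le> Max A + Max B" if "y \<in> A + B" for y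
    using that assms by (auto elim!: set_plus_elim intro: add_mono)
qed

text \<open>The right-hand side depends on \<open>B\<close> only through \<open>Max B\<close>. Small
  elements are reached with the summand 0, the others with the summand \<open>Max B\<close>.\<close>

lemma plus_initial_segment:
  assumes S: "numerical_monoid S" and c: "\<And>n. c \<le> n \<Longrightarrow> n \<in> S"
    and B: "finite B" "B \<subseteq> S" "0 \<in> B"
  shows "B + {x \<in> S. x \<le> c + Max B} = {x \<in> S. x \<le> c + 2 * Max B}"
proof (intro equalityI subsetI)
  fix x assume "x \<in> B + {x \<in> S. x \<le> c + Max B}"
  then obtain b y where "x = b + y" "b \<in> B" "y \<in> S" "y \<le> c + Max B"
    by (auto elim: set_plus_elim)
  moreover have "b \<le> Max B" using B(1) \<open>b \<in> B\<close> by simp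
  ultimately show "x \<in> {x \<in> S. x \<le> c + 2 * Max B}"
    using B(2) numerical_monoid_add[OF S] by auto
next
  fix x assume x: "x \<in> {x \<in> S. x \<le> c + 2 * Max B}"
  show "x \<in> B + {x \<in> S. x \<le> c + Max B}"
  proof (cases "x \<le> c + Max B")
    case True
    then show ?thesis using x B(3) set_plus_intro[of 0 B x] by auto
  next
    case False
    \<comment> \<open>Here \<open>x - Max B\<close> still exceeds \<open>c\<close>, hence lies in
      \<open>S\<close>.\<close>
    then have "x - Max B \<in> {x \<in> S. x \<le> c + Max B}" using x by (auto intro: c)
    moreover have "Max B \<in> B" using B by (intro Max_in) auto
    ultimately have "Max B + (x - Max B) \<in> B + {x \<in> S. x \<le> c + Max B}"
      by (intro set_plus_intro)
    then show ?thesis using False by simp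
  qed
qed

text \<open>The right-hand side speaks only of the monoid operation, so isomorphisms preserve it;
  this makes equality of maxima an invariant relation.\<close>

lemma Max_eq_iff_plus_eq:
  assumes S: "numerical_monoid S" and B: "B \<in> carrier (Pfin0 S)" and C: "C \<in> carrier (Pfin0 S)"
  shows "Max B = Max C \<longleftrightarrow> (\<exists>D\<in>carrier (Pfin0 S). B + D = C + D)"
proof
  assume eq: "Max B = Max C"
  obtain c where c: "\<And>n. c \<le> n \<Longrightarrow> n \<in> S"
    using numerical_monoid_cofinite[OF S] by blast
  let ?D = "{x \<in> S. x \<le> c + Max B}"
  have "B + ?D = C + ?D"
    using plus_initial_segment[OF S c, where B = B] plus_initial_segment[OF S c, where B = C] B C eq
    by (simp add: Pfin0_def)
  moreover have "?D \<in> carrier (Pfin0 S)"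
    using S by (auto simp: Pfin0_def numerical_monoid_def)
  ultimately show "\<exists>D\<in>carrier (Pfin0 S). B + D = C + D" by blast
next
  assume "\<exists>D\<in>carrier (Pfin0 S). B + D = C + D"
  then obtain D where D: "D \<in> carrier (Pfin0 S)" "B + D = C + D" by blast
  have "Max B + Max D = Max (B + D)"
    using B D(1) by (subst Max_set_plus) (auto simp: Pfin0_def)
  also have "\<dots> = Max C + Max D"
    unfolding D(2) using C D(1) by (subst Max_set_plus) (auto simp: Pfin0_def)
  finally show "Max B = Max C" by simp
qed

lemma additive_image_numerical_monoid_eq:
  assumes S: "numerical_monoid S" and S': "numerical_monoid S'"
    and img: "g ` S = S'"
    and add: "\<And>s t. s \<in> S \<Longrightarrow> t \<in> S \<Longrightarrow> g (s + t) = g s + g t"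
  shows "S' = S"
proof -
  have mult: "g (k * s) = k * g s" if s: "s \<in> S" for k s
  proof (induction k)
    case 0
    have "0 \<in> S" using S by (simp add: numerical_monoid_def)
    \<comment> \<open>From \<open>g 0 = g 0 + g 0\<close> follows \<open>g 0 = 0\<close>.\<close>
    from add[OF this this] show ?case by simp
  next
    case (Suc k)
    then show ?case using add[OF s numerical_monoid_mult[OF S s]] by simp
  qed
  have "g s = s" if s: "s \<in> S" for s
  proof -
    \<comment> \<open>Both sides equal \<open>g (t * s)\<close>.\<close>
    have comm: "g s * t = s * g t" if "t \<in> S" for t
      using mult[OF s, of t] mult[OF that, of s] by (simp add: mult.commute)
    have "g s = Gcd ((*) (g s) ` S)"
      using S by (simp add: Gcd_mult numerical_monoid_def)
    also have "(*) (g s) ` S = (*) s ` g ` S"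
      using comm by (simp add: image_image cong: image_cong)
    also have "Gcd \<dots> = s"
      using S' by (simp add: img Gcd_mult numerical_monoid_def)
    finally show ?thesis .
  qed
  then show ?thesis using img by force
qed

lemma Pfin0_iso_imp_eq:
  assumes S: "numerical_monoid S" and S': "numerical_monoid S'"
    and iso: "Pfin0 S \<cong> Pfin0 S'"
  shows "S' = S"
proof -
  obtain f where f: "f \<in> iso (Pfin0 S) (Pfin0 S')"
    using iso by (auto simp: is_iso_def)
  have bij: "f ` carrier (Pfin0 S) = carrier (Pfin0 S')"
    using f by (simp add: iso_def bij_betw_def)
  have hom: "f (A + B) = f A + f B" if "A \<in> carrier (Pfin0 S)" "B \<in> carrier (Pfin0 S)" for A B
    using f that by (simp add: iso_def hom_def Pfin0_def)
  have closed: "A + B \<in> carrier (Pfin0 S)" if "A \<in> carrier (Pfin0 S)" "B \<in> carrier (Pfin0 S)" for A B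
    using monoid.m_closed[OF comm_monoid.axioms(1)[OF comm_monoid_Pfin0[OF S]] that]
    by (simp add: Pfin0_def)
  have fin: "f A \<in> carrier (Pfin0 S')" if "A \<in> carrier (Pfin0 S)" for A
    using bij that by blast
  have Max_f: "Max (f A) = Max (f B)"
    if A: "A \<in> carrier (Pfin0 S)" and B: "B \<in> carrier (Pfin0 S)" and "Max A = Max B" for A B
  proof -
    obtain D where D: "D \<in> carrier (Pfin0 S)" "A + D = B + D"
      using Max_eq_iff_plus_eq[OF S A B] \<open>Max A = Max B\<close> by blast
    then have "f A + f D = f B + f D" using hom A B by metis
    then show ?thesis using Max_eq_iff_plus_eq[OF S' fin[OF A] fin[OF B]] fin[OF D(1)] by blast
  qed
  have two: "{0, s} \<in> carrier (Pfin0 S)" if "s \<in> S" for s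
    using that S by (simp add: Pfin0_def numerical_monoid_def)
  \<comment> \<open>\<open>{0, s}\<close> is a convenient representative of the sets with maximum
    \<open>s\<close>; by \<open>Max_f\<close> any other gives the same value.\<close>
  define g where "g s = Max (f {0, s})" for s
  have g_Max: "Max (f A) = g (Max A)" "Max A \<in> S" if A: "A \<in> carrier (Pfin0 S)" for A
  proof -
    have "Max A \<in> A" using A by (intro Max_in) (auto simp: Pfin0_def)
    then show "Max A \<in> S" using A by (auto simp: Pfin0_def)
    then show "Max (f A) = g (Max A)"
      unfolding g_def by (intro Max_f A two) auto
  qed
  have "g ` S = S'"
  proof (intro equalityI subsetI)
    fix y assume "y \<in> g ` S"
    then obtain s where s: "s \<in> S" "y = Max (f {0, s})" by (auto simp: g_def)
    have *: "f {0, s} \<in> carrier (Pfin0 S')" using fin[OF two[OF s(1)]] .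
    then have "Max (f {0, s}) \<in> f {0, s}" by (intro Max_in) (auto simp: Pfin0_def)
    then show "y \<in> S'" using * s(2) by (auto simp: Pfin0_def)
  next
    fix y assume "y \<in> S'"
    then have "{0, y} \<in> carrier (Pfin0 S')" using S' by (simp add: Pfin0_def numerical_monoid_def)
    then obtain A where A: "A \<in> carrier (Pfin0 S)" "f A = {0, y}" using bij by (metis imageE)
    then have "g (Max A) = y" using g_Max(1)[OF A(1)] by simp
    then show "y \<in> g ` S" using g_Max(2)[OF A(1)] by blast
  qed
  moreover have "g (s + t) = g s + g t" if st: "s \<in> S" "t \<in> S" for s t
  proof -
    \<comment> \<open>The sum \<open>{0, s} + {0, t}\<close> may differ from
      \<open>{0, s + t}\<close>, but it has the same maximum, which is all that \<open>g\<close>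
      sees.\<close>
    have "g (s + t) = g (Max ({0, s} + {0, t}))"
      by (subst Max_set_plus) auto
    also have "\<dots> = Max (f ({0, s} + {0, t}))"
      using g_Max(1)[OF closed[OF two two], OF st] by simp
    also have "\<dots> = Max (f {0, s} + f {0, t})"
      using hom[OF two two, OF st] by simp
    also have "\<dots> = g s + g t"
      unfolding g_def using fin[OF two] st by (intro Max_set_plus) (auto simp: Pfin0_def)
    finally show ?thesis .
  qed
  ultimately show ?thesis by (rule additive_image_numerical_monoid_eq[OF S S'])
qed

theorem theorem4p8:
  fixes S :: "nat set"
  assumes "numerical_monoid S"
  shows "(\<forall>S'. numerical_monoid S' \<and> Pfin0 S' \<cong> Pfin0 S \<longrightarrow>
            card (atoms S) = card (atoms S') \<and> m_of S = m_of S')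
         \<and> finite {S'. numerical_monoid S' \<and> Pfin0 S' \<cong> Pfin0 S}"
proof -
  have eq: "S' = S" if "numerical_monoid S' \<and> Pfin0 S' \<cong> Pfin0 S" for S'
    using Pfin0_iso_imp_eq[OF _ assms, of S'] that by simp
  then have "{S'. numerical_monoid S' \<and> Pfin0 S' \<cong> Pfin0 S} \<subseteq> {S}" by blast
  then show ?thesis using eq finite_subset by blast
qed

end
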